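(* Assume that each $f_i$ ($1\le i\le m$) is bounded below and continuously differentiable with $L_{\nabla f_i}$-Lipschitz gradient, that $f$ is continuously differentiable with $L_{\nabla f}$-Lipschitz gradient, and that $\mathbb{E}_{v\sim\mathcal{D}}[v_i^2]<\infty$ for $1\le i\le m$. Let $A,B,C\ge0$ be constants such that $\mathbb{E}_{v\sim\mathcal{D}}[\|\nabla f_v(\theta)\|^2]\le 2A(f(\theta)-f^{\inf})+B\|\nabla f(\theta)\|^2+C$ for all $\theta\in\mathbb{R}^d$ (such constants exist under these assumptions). Let $\eta>0$, $\zeta>0$, $\epsilon^2(\theta):=\mathbb{E}_{v\sim\mathcal{D}}[\|e_v(\theta)\|^2]$, and $$b(\zeta)=1-\tfrac{1}{2\zeta},\quad c(\zeta,\epsilon^2(\theta))=\tfrac{\zeta}{2}\epsilon^2(\theta),\quad \tilde A(\eta)=\tfrac{1+\eta}{\eta}A,\quad \tilde B(\eta)=\tfrac{1+\eta}{\eta}B,$$ $$\tilde C(\eta,\epsilon^2(\theta))=\tfrac{1+\eta}{\eta}C+(1+\eta)\epsilon^2(\theta).$$ Then for all $\theta\in\mathbb{R}^d$ the inexact stochastic gradient estimator satisfies $$\langle\nabla f(\theta),\mathbb{E}_{v\sim\mathcal{D}}[z_v(\theta)]\rangle\ge b(\zeta)\|\nabla f(\theta)\|^2-c(\zeta,\epsilon^2(\theta)),$$ $$\mathbb{E}_{v\sim\mathcal{D}}[\|z_v(\theta)\|^2]\le 2\tilde A(\eta)\,(f(\theta)-f^{\inf})+\tilde B(\eta)\|\nabla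 f(\theta)\|^2+\tilde C(\eta,\epsilon^2(\theta)).$$
   Context: Bilevel setting: $m,n,d\in\mathbb{N}$. For $i=1,\dots,m$, $h_i:\mathbb{R}^n\times\mathbb{R}^d\to\mathbb{R}$ is a lower-level objective, strongly convex in its first argument, $\hat{x}_i(\theta):=\arg\min_{x\in\mathbb{R}^n}h_i(x,\theta)$, and $f_i(\theta):=g_i(\hat{x}_i(\theta))$ for an upper-level function $g_i:\mathbb{R}^n\to\mathbb{R}$. Sampling: $\mathcal{D}$ is a distribution on $\mathbb{R}^m$ such that $v\sim\mathcal{D}$ satisfies $\mathbb{E}_{\mathcal{D}}[v_i]=1$ for all $i$. Put $f_v(\theta):=\frac1m\sum_{i=1}^m v_if_i(\theta)$, $\nabla f_v(\theta):=\frac1m\sum_{i=1}^m v_i\nabla f_i(\theta)$, and $f(\theta):=\mathbb{E}_{v\sim\mathcal{D}}[f_v(\theta)]=\frac1m\sum_{i=1}^m f_i(\theta)$. Write $f^{\inf}:=\inf_{\theta\in\mathbb{R}^d}f(\theta)$. Inexact stochastic gradient: $z_v(\theta)=\nabla f_v(\theta)+e_v(\theta)\in\mathbb{R}^d$, where $e_v(\theta)$ is the error of the hypergradient (arising because $\hat{x}_i(\theta)$ is only computed approximately). Expectations of the quantities involved are assumed to be well defined. *)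

theory Defs
  imports "HOL-Analysis.Analysis" "HOL-Probability.Probability_Measure"
begin

text \<open>
  Vectors in $R^m$, $R^n$, $R^d$ are elements of \<open>real ^ 'm\<close>, \<open>real ^ 'n\<close>, \<open>real ^ 'd\<close>; the index
  \<open>i = 1, ..., m\<close> ranges over the finite type \<open>'m\<close>, and \<open>m = CARD('m)\<close>.
\<close>

definition strongly_convex :: "('a::real_inner \<Rightarrow> real) \<Rightarrow> bool" where
  "strongly_convex f \<longleftrightarrow> (\<exists>\<mu>>0. \<forall>x y. \<forall>t\<in>{0..1}.
     f (t *\<^sub>R x + (1 - t) *\<^sub>R y)
       \<le> t * f x + (1 - t) * f y - \<mu> / 2 * t * (1 - t) * (norm (x - y))\<^sup>2)"

text \<open>The value of \<open>gradient f x\<close> is meaningful only where \<open>f\<close> is differentiable.\<close>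

definition gradient :: "('a::real_inner \<Rightarrow> real) \<Rightarrow> 'a \<Rightarrow> 'a" where
  "gradient f x = (THE D. GDERIV f x :> D)"

definition C1 :: "('a::real_inner \<Rightarrow> real) \<Rightarrow> bool" where
  "C1 f \<longleftrightarrow> (\<forall>x. \<exists>D. GDERIV f x :> D) \<and> continuous_on UNIV (gradient f)"

text \<open>\<open>ARG_MIN\<close> selects some minimiser; strong convexity makes it exist and be unique.\<close>

definition lower_solution ::
    "('m \<Rightarrow> real ^ 'n \<Rightarrow> real ^ 'd \<Rightarrow> real) \<Rightarrow> 'm \<Rightarrow> real ^ 'd \<Rightarrow> real ^ 'n" where
  "lower_solution h i \<theta> = (ARG_MIN (\<lambda>x. h i x \<theta>) x. True)"

definition bilevel_objective ::
    "('m \<Rightarrow> real ^ 'n \<Rightarrow> real) \<Rightarrow> ('m \<Rightarrow> real ^ 'n \<Rightarrow> real ^ 'd \<Rightarrow> real) \<Rightarrow> 'm \<Rightarrow> real ^ 'd \<Rightarrow> real" where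
  "bilevel_objective g h i \<theta> = g i (lower_solution h i \<theta>)"

text \<open>
  Below, \<open>F i\<close> is the \<open>i\<close>-th objective, \<open>v\<close> a sampling vector and \<open>D\<close> its distribution.
\<close>

definition sampled_objective :: "('m::finite \<Rightarrow> real ^ 'd \<Rightarrow> real) \<Rightarrow> real ^ 'm \<Rightarrow> real ^ 'd \<Rightarrow> real" where
  "sampled_objective F v \<theta> = 1 / real CARD('m) * (\<Sum>i\<in>UNIV. v $ i * F i \<theta>)"

definition sampled_gradient ::
    "('m::finite \<Rightarrow> real ^ 'd::finite \<Rightarrow> real) \<Rightarrow> real ^ 'm \<Rightarrow> real ^ 'd \<Rightarrow> real ^ 'd" where
  "sampled_gradient F v \<theta> = (1 / real CARD('m)) *\<^sub>R (\<Sum>i\<in>UNIV. v $ i *\<^sub>R gradient (F i) \<theta>)"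

definition mean_objective ::
    "(real ^ 'm) measure \<Rightarrow> ('m::finite \<Rightarrow> real ^ 'd \<Rightarrow> real) \<Rightarrow> real ^ 'd \<Rightarrow> real" where
  "mean_objective D F \<theta> = (\<integral>v. sampled_objective F v \<theta> \<partial>D)"

text \<open>
  The second-moment bound on the exact stochastic gradient; \<open>INF\<close> is the real
  infimum, which is meaningful only if the mean objective is bounded below.
\<close>

definition second_moment_bound ::
    "(real ^ 'm) measure \<Rightarrow> ('m::finite \<Rightarrow> real ^ 'd::finite \<Rightarrow> real) \<Rightarrow> real \<Rightarrow> real \<Rightarrow> real \<Rightarrow> bool" where
  "second_moment_bound D F A B C \<longleftrightarrow>
     (\<forall>\<theta>. (\<integral>v. (norm (sampled_gradient F v \<theta>))\<^sup>2 \<partial>D)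
        \<le> 2 * A * (mean_objective D F \<theta> - (INF \<theta>'. mean_objective D F \<theta>'))
          + B * (norm (gradient (mean_objective D F) \<theta>))\<^sup>2 + C)"

text \<open>
  \<open>e v \<theta>\<close> is the hypergradient error; the functions below whose last argument is \<open>\<epsilon>2\<close> take the
  value of $\epsilon^2(\theta)$ there.
\<close>

definition inexact_gradient ::
    "('m::finite \<Rightarrow> real ^ 'd::finite \<Rightarrow> real) \<Rightarrow> (real ^ 'm \<Rightarrow> real ^ 'd \<Rightarrow> real ^ 'd)
       \<Rightarrow> real ^ 'm \<Rightarrow> real ^ 'd \<Rightarrow> real ^ 'd" where
  "inexact_gradient F e v \<theta> = sampled_gradient F v \<theta> + e v \<theta>"

definition mean_sq_error ::
    "(real ^ 'm) measure \<Rightarrow> (real ^ 'm \<Rightarrow> real ^ 'd \<Rightarrow> real ^ 'd::finite) \<Rightarrow> real ^ 'd \<Rightarrow> real" where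
  "mean_sq_error D e \<theta> = (\<integral>v. (norm (e v \<theta>))\<^sup>2 \<partial>D)"

definition b_coeff :: "real \<Rightarrow> real" where
  "b_coeff \<zeta> = 1 - 1 / (2 * \<zeta>)"

definition c_coeff :: "real \<Rightarrow> real \<Rightarrow> real" where
  "c_coeff \<zeta> \<epsilon>2 = \<zeta> / 2 * \<epsilon>2"

definition A_tilde :: "real \<Rightarrow> real \<Rightarrow> real" where
  "A_tilde A \<eta> = (1 + \<eta>) / \<eta> * A"

definition B_tilde :: "real \<Rightarrow> real \<Rightarrow> real" where
  "B_tilde B \<eta> = (1 + \<eta>) / \<eta> * B"

definition C_tilde :: "real \<Rightarrow> real \<Rightarrow> real \<Rightarrow> real" where
  "C_tilde C \<eta> \<epsilon>2 = (1 + \<eta>) / \<eta> * C + (1 + \<eta>) * \<epsilon>2"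

end

theory Submission
  imports Defs
begin

text \<open>
  Both inequalities compare the estimator \<open>z\<^sub>v = \<nabla>f\<^sub>v + e\<^sub>v\<close> with its exact part
  \<open>\<nabla>f\<^sub>v\<close>, which is unbiased because every \<open>v\<^sub>i\<close> has mean one. Nothing is known about how the error
  \<open>e\<^sub>v\<close> correlates with \<open>\<nabla>f\<^sub>v\<close>, so the cross terms \<open>\<langle>\<nabla>f, e\<^sub>v\<rangle>\<close> and \<open>\<langle>\<nabla>f\<^sub>v, e\<^sub>v\<rangle>\<close> are split by Young's
  inequality, \<open>\<langle>a, b\<rangle> \<le> \<parallel>a\<parallel>\<^sup>2 / (2 z) + z / 2 * \<parallel>b\<parallel>\<^sup>2\<close>, before taking expectations
  (\<open>inner_integral_add_ge\<close> and \<open>integral_norm_add_squared_le\<close>). The parameters \<open>\<zeta>\<close> and \<open>\<eta>\<close> are the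
  free weights \<open>z\<close> of these two splittings.

  Constants \<open>A, B, C\<close> exist for a different reason. A function with \<open>L\<close>-Lipschitz gradient decreases
  by at least \<open>\<parallel>\<nabla>f\<parallel>\<^sup>2 / (2 L)\<close> along a gradient step of length \<open>1 / L\<close>; if it is bounded below, its
  squared gradient is therefore at most \<open>2 L\<close> times the gap to the lower bound
  (\<open>norm_gradient_squared_le_gap\<close>). Applied to every \<open>f\<^sub>i\<close> and summed with the weights
  \<open>E [v\<^sub>i\<^sup>2]\<close>, this bounds the second moment of \<open>\<nabla>f\<^sub>v\<close> by a multiple of the average of
  \<open>f\<^sub>i - inf f\<^sub>i\<close>. That average is \<open>f - inf f\<close> plus the constant \<open>inf f - (1/m) \<Sum>\<^sub>i inf f\<^sub>i\<close>,
  which is nonnegative since an infimum of averages is at least the average of the infima, and which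
  accounts for \<open>C\<close>; one may take \<open>B = 0\<close> (\<open>second_moment_bound_exists\<close>).
\<close>

section \<open>Young's inequality and its expected forms\<close>

text \<open>Expand \<open>0 \<le> \<parallel>a - z b\<parallel>\<^sup>2\<close> and divide by \<open>2 z\<close>.\<close>

lemma inner_le_Young:
  fixes a b :: "'a::real_inner"
  assumes "0 < z"
  shows "a \<bullet> b \<le> (norm a)\<^sup>2 / (2 * z) + z / 2 * (norm b)\<^sup>2"
proof -
  have "0 \<le> (norm (a - z *\<^sub>R b))\<^sup>2"
    by simp
  also have "\<dots> = (norm a)\<^sup>2 - 2 * z * (a \<bullet> b) + z\<^sup>2 * (norm b)\<^sup>2"
    unfolding power2_norm_eq_inner
    by (simp add: inner_diff inner_commute algebra_simps power2_eq_square)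
  finally have "2 * z * (a \<bullet> b) \<le> (norm a)\<^sup>2 + z\<^sup>2 * (norm b)\<^sup>2"
    by simp
  then show ?thesis
    using assms by (simp add: field_simps power2_eq_square)
qed

lemma norm_add_squared_le:
  fixes a b :: "'a::real_inner"
  assumes "0 < \<eta>"
  shows "(norm (a + b))\<^sup>2 \<le> (1 + \<eta>) / \<eta> * (norm a)\<^sup>2 + (1 + \<eta>) * (norm b)\<^sup>2"
proof -
  have "(norm (a + b))\<^sup>2 = (norm a)\<^sup>2 + 2 * (a \<bullet> b) + (norm b)\<^sup>2"
    by (simp add: power2_norm_eq_inner inner_add inner_commute)
  also have "\<dots> \<le> (norm a)\<^sup>2 + 2 * ((norm a)\<^sup>2 / (2 * \<eta>) + \<eta> / 2 * (norm b)\<^sup>2) + (norm b)\<^sup>2"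
    using inner_le_Young[OF assms, of a b] by simp
  also have "\<dots> = (1 + \<eta>) / \<eta> * (norm a)\<^sup>2 + (1 + \<eta>) * (norm b)\<^sup>2"
    using assms by (simp add: field_simps)
  finally show ?thesis .
qed

lemma (in finite_measure) integrable_if_norm_squared_integrable:
  fixes X :: "'a \<Rightarrow> 'b::{banach, second_countable_topology}"
  assumes [measurable]: "X \<in> borel_measurable M"
    and "integrable M (\<lambda>\<omega>. (norm (X \<omega>))\<^sup>2)"
  shows "integrable M X"
proof -
  have "integrable M (\<lambda>\<omega>. norm (X \<omega>))"
    by (rule square_integrable_imp_integrable) (use assms in auto)
  then show ?thesis
    by (simp add: integrable_norm_iff)
qed

text \<open>
  The part \<open>X\<close> contributes exactly \<open>\<parallel>u\<parallel>\<^sup>2\<close> to the inner product, and Young's inequality, applied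
  pointwise to \<open>- u\<close> and \<open>Y\<close>, limits how much the error \<open>Y\<close> can take away.
\<close>

lemma (in prob_space) inner_integral_add_ge:
  fixes X Y :: "'a \<Rightarrow> 'b::euclidean_space"
  assumes X: "integrable M X"
    and Y_measurable: "Y \<in> borel_measurable M"
    and Y_square: "integrable M (\<lambda>\<omega>. (norm (Y \<omega>))\<^sup>2)"
    and z: "0 < z"
  defines "u \<equiv> expectation X"
  shows "u \<bullet> expectation (\<lambda>\<omega>. X \<omega> + Y \<omega>)
    \<ge> (1 - 1 / (2 * z)) * (norm u)\<^sup>2 - z / 2 * expectation (\<lambda>\<omega>. (norm (Y \<omega>))\<^sup>2)"
proof -
  have Y: "integrable M Y"
    using Y_measurable Y_square by (rule integrable_if_norm_squared_integrable)
  have "- (u \<bullet> expectation Y) = expectation (\<lambda>\<omega>. - u \<bullet> Y \<omega>)"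
    using Y by simp
  also have "\<dots> \<le> expectation (\<lambda>\<omega>. (norm u)\<^sup>2 / (2 * z) + z / 2 * (norm (Y \<omega>))\<^sup>2)"
  proof (rule integral_mono)
    show "- u \<bullet> Y \<omega> \<le> (norm u)\<^sup>2 / (2 * z) + z / 2 * (norm (Y \<omega>))\<^sup>2" for \<omega>
      using inner_le_Young[OF z, of "- u" "Y \<omega>"] by simp
  qed (use Y Y_square in simp_all)
  also have "\<dots> = (norm u)\<^sup>2 / (2 * z) + z / 2 * expectation (\<lambda>\<omega>. (norm (Y \<omega>))\<^sup>2)"
    using Y_square by (simp add: prob_space)
  finally have "- (u \<bullet> expectation Y)
      \<le> (norm u)\<^sup>2 / (2 * z) + z / 2 * expectation (\<lambda>\<omega>. (norm (Y \<omega>))\<^sup>2)" .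
  moreover have "u \<bullet> expectation (\<lambda>\<omega>. X \<omega> + Y \<omega>) = (norm u)\<^sup>2 + u \<bullet> expectation Y"
    using X Y by (simp add: u_def inner_add_right power2_norm_eq_inner)
  ultimately show ?thesis
    by (simp add: algebra_simps)
qed

lemma integral_norm_add_squared_le:
  fixes X Y :: "'a \<Rightarrow> 'b::euclidean_space"
  assumes X_square: "integrable M (\<lambda>\<omega>. (norm (X \<omega>))\<^sup>2)"
    and Y_square: "integrable M (\<lambda>\<omega>. (norm (Y \<omega>))\<^sup>2)"
    and [measurable]: "X \<in> borel_measurable M" "Y \<in> borel_measurable M"
    and \<eta>: "0 < \<eta>"
  shows "(\<integral>\<omega>. (norm (X \<omega> + Y \<omega>))\<^sup>2 \<partial>M)
    \<le> (1 + \<eta>) / \<eta> * (\<integral>\<omega>. (norm (X \<omega>))\<^sup>2 \<partial>M) + (1 + \<eta>) * (\<integral>\<omega>. (norm (Y \<omega>))\<^sup>2 \<partial>M)"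
proof -
  let ?bound = "\<lambda>\<omega>. (1 + \<eta>) / \<eta> * (norm (X \<omega>))\<^sup>2 + (1 + \<eta>) * (norm (Y \<omega>))\<^sup>2"
  have pointwise: "(norm (X \<omega> + Y \<omega>))\<^sup>2 \<le> ?bound \<omega>" for \<omega>
    using norm_add_squared_le[OF \<eta>] .
  have bound: "integrable M ?bound"
    using X_square Y_square by (intro Bochner_Integration.integrable_add integrable_mult_right)
  have "integrable M (\<lambda>\<omega>. (norm (X \<omega> + Y \<omega>))\<^sup>2)"
  proof (rule Bochner_Integration.integrable_bound[OF bound])
    show "AE \<omega> in M. norm ((norm (X \<omega> + Y \<omega>))\<^sup>2) \<le> norm (?bound \<omega>)"
      using pointwise by (intro AE_I2) (simp, meson abs_ge_self order_trans)
  qed measurable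
  then have "(\<integral>\<omega>. (norm (X \<omega> + Y \<omega>))\<^sup>2 \<partial>M) \<le> (\<integral>\<omega>. ?bound \<omega> \<partial>M)"
    using bound pointwise by (rule integral_mono)
  also have "\<dots> = (1 + \<eta>) / \<eta> * (\<integral>\<omega>. (norm (X \<omega>))\<^sup>2 \<partial>M) + (1 + \<eta>) * (\<integral>\<omega>. (norm (Y \<omega>))\<^sup>2 \<partial>M)"
    using X_square Y_square by simp
  finally show ?thesis .
qed

section \<open>Functions with Lipschitz gradient\<close>

lemma gradient_eqI:
  assumes "GDERIV f x :> G"
  shows "gradient f x = G"
  unfolding gradient_def
proof (rule the_equality)
  fix G'
  assume "GDERIV f x :> G'"
  with assms have "(\<lambda>h. h \<bullet> G') = (\<lambda>h. h \<bullet> G)"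
    unfolding gderiv_def using has_derivative_unique by blast
  then show "G' = G"
    by (metis vector_eq_ldot)
qed (fact assms)

lemma C1_GDERIV: "C1 f \<Longrightarrow> GDERIV f x :> gradient f x"
  unfolding C1_def using gradient_eqI by metis

text \<open>
  Along the segment from \<open>x\<close> to \<open>x + d\<close>, the gap between \<open>f\<close> and its quadratic majorant has
  derivative \<open>\<langle>\<nabla>f (x + t d) - \<nabla>f x, d\<rangle> - L t \<parallel>d\<parallel>\<^sup>2\<close>, which is nonpositive for \<open>t \<ge> 0\<close> by
  Cauchy-Schwarz and the Lipschitz bound.
\<close>

lemma descent_lemma:
  fixes f :: "'a::real_inner \<Rightarrow> real"
  assumes f: "C1 f" and L: "L-lipschitz_on UNIV (gradient f)"
  shows "f (x + d) \<le> f x + gradient f x \<bullet> d + L / 2 * (norm d)\<^sup>2"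
proof -
  define \<phi> where "\<phi> t = f (x + t *\<^sub>R d) - t * (gradient f x \<bullet> d) - L / 2 * t\<^sup>2 * (norm d)\<^sup>2" for t
  define \<phi>' where "\<phi>' t = (gradient f (x + t *\<^sub>R d) - gradient f x) \<bullet> d - L * t * (norm d)\<^sup>2" for t
  have deriv: "DERIV \<phi> t :> \<phi>' t" for t
  proof -
    have f': "(f has_derivative (\<lambda>h. h \<bullet> gradient f (x + t *\<^sub>R d))) (at (x + t *\<^sub>R d))"
      using C1_GDERIV[OF f] by (simp add: gderiv_def)
    have line: "((\<lambda>t. x + t *\<^sub>R d) has_derivative (\<lambda>s. s *\<^sub>R d)) (at t)"
      by (auto intro!: derivative_eq_intros)
    have "((\<lambda>t. f (x + t *\<^sub>R d)) has_derivative (\<lambda>s. (s *\<^sub>R d) \<bullet> gradient f (x + t *\<^sub>R d))) (at t)"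
      using has_derivative_compose[OF line f'] .
    then have "DERIV (\<lambda>t. f (x + t *\<^sub>R d)) t :> d \<bullet> gradient f (x + t *\<^sub>R d)"
      by (rule has_derivative_imp_has_field_derivative) simp
    then show ?thesis
      unfolding \<phi>_def \<phi>'_def
      by (auto intro!: derivative_eq_intros simp: inner_diff_left inner_commute algebra_simps)
  qed
  have nonpos: "\<phi>' t \<le> 0" if "0 \<le> t" for t
  proof -
    have "(gradient f (x + t *\<^sub>R d) - gradient f x) \<bullet> d
        \<le> norm (gradient f (x + t *\<^sub>R d) - gradient f x) * norm d"
      by (rule norm_cauchy_schwarz)
    also have "\<dots> \<le> (L * norm (t *\<^sub>R d)) * norm d"
      using lipschitz_onD[OF L, of "x + t *\<^sub>R d" x] by (intro mult_right_mono) (simp_all add: dist_norm)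
    also have "\<dots> = L * t * (norm d)\<^sup>2"
      using that by (simp add: power2_eq_square)
    finally show ?thesis
      by (simp add: \<phi>'_def)
  qed
  have "\<phi> 1 \<le> \<phi> 0"
    by (rule DERIV_nonpos_imp_nonincreasing[of 0 1]) (use deriv nonpos in auto)
  then show ?thesis
    by (simp add: \<phi>_def)
qed

text \<open>
  The step \<open>d = - \<nabla>f x / L\<close> minimises the quadratic majorant of \<open>f\<close> at \<open>x\<close>; the value reached
  there cannot be below \<open>l\<close>.
\<close>

lemma norm_gradient_squared_le_gap:
  fixes f :: "'a::real_inner \<Rightarrow> real"
  assumes f: "C1 f" and L: "L-lipschitz_on UNIV (gradient f)" and "0 < L"
    and lower: "\<And>y. l \<le> f y"
  shows "(norm (gradient f x))\<^sup>2 \<le> 2 * L * (f x - l)"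
proof -
  let ?d = "(- 1 / L) *\<^sub>R gradient f x"
  have "l \<le> f (x + ?d)"
    by (rule lower)
  also have "\<dots> \<le> f x + gradient f x \<bullet> ?d + L / 2 * (norm ?d)\<^sup>2"
    by (rule descent_lemma[OF f L])
  also have "\<dots> = f x - (norm (gradient f x))\<^sup>2 / (2 * L)"
    using \<open>0 < L\<close> by (simp add: power2_norm_eq_inner[symmetric] power_divide power2_eq_square field_simps)
  finally show ?thesis
    using \<open>0 < L\<close> by (simp add: field_simps)
qed

section \<open>The exact stochastic gradient\<close>

lemma mean_objective_eq_average:
  fixes F :: "'m::finite \<Rightarrow> real ^ 'd \<Rightarrow> real"
  assumes "\<And>i. integrable D (\<lambda>v. v $ i)" and "\<And>i. (\<integral>v. v $ i \<partial>D) = 1"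
  shows "mean_objective D F \<theta> = (\<Sum>i\<in>UNIV. F i \<theta>) / real CARD('m)"
  using assms by (simp add: mean_objective_def sampled_objective_def)

lemma gradient_mean_objective:
  fixes F :: "'m::finite \<Rightarrow> real ^ 'd::finite \<Rightarrow> real"
  assumes "\<And>i. integrable D (\<lambda>v. v $ i)" and "\<And>i. (\<integral>v. v $ i \<partial>D) = 1"
    and F: "\<And>i. C1 (F i)"
  shows "gradient (mean_objective D F) \<theta> = (1 / real CARD('m)) *\<^sub>R (\<Sum>i\<in>UNIV. gradient (F i) \<theta>)"
proof (rule gradient_eqI)
  have "((\<lambda>\<theta>. (1 / real CARD('m)) * (\<Sum>i\<in>UNIV. F i \<theta>)) has_derivative
      (\<lambda>h. (1 / real CARD('m)) * (\<Sum>i\<in>UNIV. h \<bullet> gradient (F i) \<theta>))) (at \<theta>)"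
    using C1_GDERIV[OF F] unfolding gderiv_def
    by (intro has_derivative_mult_right has_derivative_sum) auto
  moreover have "mean_objective D F = (\<lambda>\<theta>. (1 / real CARD('m)) * (\<Sum>i\<in>UNIV. F i \<theta>))"
    by (simp add: fun_eq_iff mean_objective_eq_average[OF assms(1,2)])
  ultimately show "GDERIV (mean_objective D F) \<theta> :> (1 / real CARD('m)) *\<^sub>R (\<Sum>i\<in>UNIV. gradient (F i) \<theta>)"
    by (simp add: gderiv_def inner_sum_right)
qed

lemma integrable_sampled_gradient:
  fixes F :: "'m::finite \<Rightarrow> real ^ 'd::finite \<Rightarrow> real"
  assumes "\<And>i. integrable D (\<lambda>v. v $ i)"
  shows "integrable D (\<lambda>v. sampled_gradient F v \<theta>)"
  unfolding sampled_gradient_def using assms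
  by (intro integrable_scaleR_right Bochner_Integration.integrable_sum integrable_scaleR_left)

lemma integral_sampled_gradient:
  fixes F :: "'m::finite \<Rightarrow> real ^ 'd::finite \<Rightarrow> real"
  assumes v: "\<And>i. integrable D (\<lambda>v. v $ i)" and "\<And>i. (\<integral>v. v $ i \<partial>D) = 1"
    and "\<And>i. C1 (F i)"
  shows "(\<integral>v. sampled_gradient F v \<theta> \<partial>D) = gradient (mean_objective D F) \<theta>"
proof -
  have "(\<integral>v. (\<Sum>i\<in>UNIV. v $ i *\<^sub>R gradient (F i) \<theta>) \<partial>D) = (\<Sum>i\<in>UNIV. gradient (F i) \<theta>)"
    using v assms(2) by simp
  then show ?thesis
    by (simp add: sampled_gradient_def gradient_mean_objective[OF assms])
qed

text \<open>
  By Cauchy-Schwarz, the squared norm of an average is at most the average of the squared norms.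
  Each resulting summand depends on \<open>v\<close> through a single \<open>v\<^sub>i\<^sup>2\<close>, so its mean is finite and known
  from the second moments alone.
\<close>

lemma norm_sampled_gradient_squared_le:
  fixes F :: "'m::finite \<Rightarrow> real ^ 'd::finite \<Rightarrow> real"
  shows "(norm (sampled_gradient F v \<theta>))\<^sup>2
    \<le> (\<Sum>i\<in>UNIV. (v $ i)\<^sup>2 * (norm (gradient (F i) \<theta>))\<^sup>2) / real CARD('m)"
proof -
  let ?m = "real CARD('m)"
  have "norm (sampled_gradient F v \<theta>) \<le> (\<Sum>i\<in>UNIV. \<bar>v $ i\<bar> * norm (gradient (F i) \<theta>)) / ?m"
    unfolding sampled_gradient_def
    using norm_sum[of "\<lambda>i. v $ i *\<^sub>R gradient (F i) \<theta>" UNIV] by (simp add: divide_right_mono)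
  then have "(norm (sampled_gradient F v \<theta>))\<^sup>2
      \<le> ((\<Sum>i\<in>UNIV. \<bar>v $ i\<bar> * norm (gradient (F i) \<theta>)) / ?m)\<^sup>2"
    by (simp add: power_mono)
  also have "\<dots> \<le> ((\<Sum>i\<in>UNIV. (\<bar>v $ i\<bar> * norm (gradient (F i) \<theta>))\<^sup>2) * ?m) / ?m\<^sup>2"
    unfolding power_divide by (intro divide_right_mono sum_squared_le_sum_of_squares) simp
  also have "\<dots> = (\<Sum>i\<in>UNIV. (v $ i)\<^sup>2 * (norm (gradient (F i) \<theta>))\<^sup>2) / ?m"
    unfolding power_mult_distrib power2_abs by (simp add: power2_eq_square)
  finally show ?thesis .
qed

lemma integrable_norm_sampled_gradient_squared:
  fixes F :: "'m::finite \<Rightarrow> real ^ 'd::finite \<Rightarrow> real"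
  assumes "\<And>i. integrable D (\<lambda>v. v $ i)" and "\<And>i. integrable D (\<lambda>v. (v $ i)\<^sup>2)"
  shows "integrable D (\<lambda>v. (norm (sampled_gradient F v \<theta>))\<^sup>2)"
proof (rule Bochner_Integration.integrable_bound)
  show "integrable D (\<lambda>v. (\<Sum>i\<in>UNIV. (v $ i)\<^sup>2 * (norm (gradient (F i) \<theta>))\<^sup>2) / real CARD('m))"
    using assms(2) by simp
  show "(\<lambda>v. (norm (sampled_gradient F v \<theta>))\<^sup>2) \<in> borel_measurable D"
    using borel_measurable_integrable[OF integrable_sampled_gradient[OF assms(1)]] by measurable
  show "AE v in D. norm ((norm (sampled_gradient F v \<theta>))\<^sup>2)
      \<le> norm ((\<Sum>i\<in>UNIV. (v $ i)\<^sup>2 * (norm (gradient (F i) \<theta>))\<^sup>2) / real CARD('m))"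
    by (intro AE_I2) (simp only: real_norm_def abs_power2
        order_trans[OF norm_sampled_gradient_squared_le abs_ge_self])
qed

text \<open>
  Each \<open>\<parallel>\<nabla>f\<^sub>i\<parallel>\<^sup>2\<close> is controlled by the gap \<open>f\<^sub>i - inf f\<^sub>i\<close>. Replacing the different weights of these gaps
  by their sum \<open>A\<close> makes the gaps recombine into \<open>f\<close>, and the average of the individual infima differs from
  \<open>inf f\<close> only by a constant.
\<close>

lemma second_moment_bound_exists:
  fixes F :: "'m::finite \<Rightarrow> real ^ 'd::finite \<Rightarrow> real"
  assumes v: "\<And>i. integrable D (\<lambda>v. v $ i)" and v_mean: "\<And>i. (\<integral>v. v $ i \<partial>D) = 1"
    and v_square: "\<And>i. integrable D (\<lambda>v. (v $ i)\<^sup>2)"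
    and F: "\<And>i. C1 (F i)" and F_bdd: "\<And>i. bdd_below (range (F i))"
    and F_lipschitz: "\<And>i. (L i)-lipschitz_on UNIV (gradient (F i))"
  shows "\<exists>A\<ge>0. \<exists>B\<ge>0. \<exists>C\<ge>0. second_moment_bound D F A B C"
proof -
  let ?m = "real CARD('m)"
  let ?f = "mean_objective D F"
  define l where "l i = (INF \<theta>. F i \<theta>)" for i
  define s where "s i = (\<integral>v. (v $ i)\<^sup>2 \<partial>D)" for i
  \<comment> \<open>The summand \<open>1\<close> keeps the Lipschitz constant positive, as a gradient step of length
    \<open>1 / L\<close> requires, even for \<open>L i = 0\<close>.\<close>
  define A where "A = (\<Sum>i\<in>UNIV. s i * (L i + 1))"
  define C where "C = 2 * A * ((INF \<theta>. ?f \<theta>) - (\<Sum>i\<in>UNIV. l i) / ?m)"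
  have L_nonneg: "0 \<le> L i" for i
    using F_lipschitz lipschitz_on_nonneg by blast
  have s_nonneg: "0 \<le> s i" for i
    by (simp add: s_def)
  have A_ge: "s i * (L i + 1) \<le> A" for i
    unfolding A_def using s_nonneg L_nonneg
    by (intro member_le_sum) (auto intro!: mult_nonneg_nonneg add_nonneg_nonneg)
  have A_nonneg: "0 \<le> A"
    unfolding A_def using s_nonneg L_nonneg
    by (intro sum_nonneg mult_nonneg_nonneg add_nonneg_nonneg) auto
  have l_le: "l i \<le> F i \<theta>" for i \<theta>
    unfolding l_def using F_bdd by (intro cINF_lower) auto
  have "(\<Sum>i\<in>UNIV. l i) / ?m \<le> ?f \<theta>" for \<theta>
    using l_le by (simp add: mean_objective_eq_average[OF v v_mean] divide_right_mono sum_mono)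
  then have "(\<Sum>i\<in>UNIV. l i) / ?m \<le> (INF \<theta>. ?f \<theta>)"
    by (intro cINF_greatest) auto
  then have C_nonneg: "0 \<le> C"
    using A_nonneg by (simp add: C_def)
  have gradient_le: "(norm (gradient (F i) \<theta>))\<^sup>2 \<le> 2 * (L i + 1) * (F i \<theta> - l i)" for i \<theta>
  proof (rule norm_gradient_squared_le_gap[OF F])
    show "(L i + 1)-lipschitz_on UNIV (gradient (F i))"
      using F_lipschitz by (rule lipschitz_on_mono) auto
    show "0 < L i + 1"
      using L_nonneg[of i] by simp
  qed (rule l_le)
  have "(\<integral>v. (norm (sampled_gradient F v \<theta>))\<^sup>2 \<partial>D) \<le> 2 * A * (?f \<theta> - (INF \<theta>'. ?f \<theta>')) + C" for \<theta>
  proof -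
    have "(\<integral>v. (norm (sampled_gradient F v \<theta>))\<^sup>2 \<partial>D)
        \<le> (\<integral>v. (\<Sum>i\<in>UNIV. (v $ i)\<^sup>2 * (norm (gradient (F i) \<theta>))\<^sup>2) / ?m \<partial>D)"
      by (intro integral_mono integrable_norm_sampled_gradient_squared norm_sampled_gradient_squared_le
          v v_square) (simp add: v_square)
    also have "\<dots> = (\<Sum>i\<in>UNIV. s i * (norm (gradient (F i) \<theta>))\<^sup>2) / ?m"
      using v_square by (simp add: s_def)
    also have "\<dots> \<le> (\<Sum>i\<in>UNIV. 2 * A * (F i \<theta> - l i)) / ?m"
    proof (intro divide_right_mono sum_mono)
      fix i
      have "s i * (norm (gradient (F i) \<theta>))\<^sup>2 \<le> s i * (2 * (L i + 1) * (F i \<theta> - l i))"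
        using gradient_le s_nonneg by (intro mult_left_mono)
      also have "\<dots> = (s i * (L i + 1)) * (2 * (F i \<theta> - l i))"
        by (simp add: algebra_simps)
      also have "\<dots> \<le> A * (2 * (F i \<theta> - l i))"
        using A_ge l_le[of i \<theta>] by (intro mult_right_mono) auto
      finally show "s i * (norm (gradient (F i) \<theta>))\<^sup>2 \<le> 2 * A * (F i \<theta> - l i)"
        by (simp add: mult.assoc mult.left_commute)
    qed simp
    also have "\<dots> = 2 * A * (?f \<theta> - (\<Sum>i\<in>UNIV. l i) / ?m)"
      by (simp add: mean_objective_eq_average[OF v v_mean] sum_distrib_left[symmetric]
          sum_subtractf diff_divide_distrib[symmetric])
    also have "\<dots> = 2 * A * (?f \<theta> - (INF \<theta>'. ?f \<theta>')) + C"
      by (simp add: C_def algebra_simps)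
    finally show ?thesis .
  qed
  then have "second_moment_bound D F A 0 C"
    by (simp add: second_moment_bound_def)
  with A_nonneg C_nonneg show ?thesis
    by (intro exI[of _ A] exI[of _ "0 :: real"] exI[of _ C] conjI) simp_all
qed

section \<open>The inexact stochastic gradient\<close>

theorem proposition1:
  fixes h :: "'m::finite \<Rightarrow> real ^ 'n::finite \<Rightarrow> real ^ 'd::finite \<Rightarrow> real"
    and g :: "'m \<Rightarrow> real ^ 'n \<Rightarrow> real"
    and D :: "(real ^ 'm) measure"
    and e :: "real ^ 'm \<Rightarrow> real ^ 'd \<Rightarrow> real ^ 'd"
    and Lfi :: "'m \<Rightarrow> real" and Lf :: real
    and fi :: "'m \<Rightarrow> real ^ 'd \<Rightarrow> real" and f :: "real ^ 'd \<Rightarrow> real"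
  assumes lower_strongly_convex: "\<And>i \<theta>. strongly_convex (\<lambda>x. h i x \<theta>)"
    and fi_eq: "fi = bilevel_objective g h"
    and D_prob: "prob_space D" and D_sets: "sets D = sets borel"
    and D_integrable: "\<And>i. integrable D (\<lambda>v. v $ i)"
    and D_mean: "\<And>i. (\<integral>v. v $ i \<partial>D) = 1"
    and f_eq: "f = mean_objective D fi"
    and fi_bdd_below: "\<And>i. bdd_below (range (fi i))"
    and fi_C1: "\<And>i. C1 (fi i)"
    and fi_smooth: "\<And>i. (Lfi i)-lipschitz_on UNIV (gradient (fi i))"
    and f_C1: "C1 f"
    and f_smooth: "Lf-lipschitz_on UNIV (gradient f)"
    and D_second_moment: "\<And>i. integrable D (\<lambda>v. (v $ i)\<^sup>2)"
    and e_measurable: "\<And>\<theta>. (\<lambda>v. e v \<theta>) \<in> borel_measurable D"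
    and e_second_moment: "\<And>\<theta>. integrable D (\<lambda>v. (norm (e v \<theta>))\<^sup>2)"
  shows "(\<exists>A\<ge>0. \<exists>B\<ge>0. \<exists>C\<ge>0. second_moment_bound D fi A B C) \<and>
    (\<forall>A\<ge>0. \<forall>B\<ge>0. \<forall>C\<ge>0. second_moment_bound D fi A B C \<longrightarrow>
      (\<forall>\<eta>>0. \<forall>\<zeta>>0. \<forall>\<theta>.
         gradient f \<theta> \<bullet> (\<integral>v. inexact_gradient fi e v \<theta> \<partial>D)
           \<ge> b_coeff \<zeta> * (norm (gradient f \<theta>))\<^sup>2 - c_coeff \<zeta> (mean_sq_error D e \<theta>) \<and>
         (\<integral>v. (norm (inexact_gradient fi e v \<theta>))\<^sup>2 \<partial>D)
           \<le> 2 * A_tilde A \<eta> * (f \<theta> - (INF \<theta>'. f \<theta>'))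
             + B_tilde B \<eta> * (norm (gradient f \<theta>))\<^sup>2
             + C_tilde C \<eta> (mean_sq_error D e \<theta>)))"
proof -
  interpret prob_space D
    by (rule D_prob)
  have G: "integrable D (\<lambda>v. sampled_gradient fi v \<theta>)" for \<theta>
    by (rule integrable_sampled_gradient[OF D_integrable])
  have G_square: "integrable D (\<lambda>v. (norm (sampled_gradient fi v \<theta>))\<^sup>2)" for \<theta>
    by (rule integrable_norm_sampled_gradient_squared[OF D_integrable D_second_moment])
  have G_mean: "expectation (\<lambda>v. sampled_gradient fi v \<theta>) = gradient f \<theta>" for \<theta>
    unfolding f_eq by (rule integral_sampled_gradient[OF D_integrable D_mean fi_C1])
  have correlation: "gradient f \<theta> \<bullet> (\<integral>v. inexact_gradient fi e v \<theta> \<partial>D)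
      \<ge> b_coeff \<zeta> * (norm (gradient f \<theta>))\<^sup>2 - c_coeff \<zeta> (mean_sq_error D e \<theta>)"
    if "0 < \<zeta>" for \<zeta> \<theta>
    using inner_integral_add_ge[OF G e_measurable e_second_moment that]
    by (simp add: G_mean inexact_gradient_def b_coeff_def c_coeff_def mean_sq_error_def)
  have second_moment: "(\<integral>v. (norm (inexact_gradient fi e v \<theta>))\<^sup>2 \<partial>D)
      \<le> 2 * A_tilde A \<eta> * (f \<theta> - (INF \<theta>'. f \<theta>'))
        + B_tilde B \<eta> * (norm (gradient f \<theta>))\<^sup>2
        + C_tilde C \<eta> (mean_sq_error D e \<theta>)"
    if bound: "second_moment_bound D fi A B C" and \<eta>: "0 < \<eta>" for A B C \<eta> \<theta>
  proof -
    let ?rhs = "2 * A * (f \<theta> - (INF \<theta>'. f \<theta>')) + B * (norm (gradient f \<theta>))\<^sup>2 + C"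
    have "(\<integral>v. (norm (inexact_gradient fi e v \<theta>))\<^sup>2 \<partial>D)
        \<le> (1 + \<eta>) / \<eta> * (\<integral>v. (norm (sampled_gradient fi v \<theta>))\<^sup>2 \<partial>D)
          + (1 + \<eta>) * mean_sq_error D e \<theta>"
      unfolding inexact_gradient_def mean_sq_error_def
      by (rule integral_norm_add_squared_le[OF G_square e_second_moment
            borel_measurable_integrable[OF G] e_measurable \<eta>])
    also have "\<dots> \<le> (1 + \<eta>) / \<eta> * ?rhs + (1 + \<eta>) * mean_sq_error D e \<theta>"
      using bound \<eta> unfolding second_moment_bound_def f_eq
      by (intro add_right_mono mult_left_mono) auto
    also have "\<dots> = 2 * A_tilde A \<eta> * (f \<theta> - (INF \<theta>'. f \<theta>'))
        + B_tilde B \<eta> * (norm (gradient f \<theta>))\<^sup>2 + C_tilde C \<eta> (mean_sq_error D e \<theta>)"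
      unfolding A_tilde_def B_tilde_def C_tilde_def by (simp only: distrib_left mult_ac add_ac)
    finally show ?thesis .
  qed
  show ?thesis
  proof (intro conjI allI impI)
    show "\<exists>A\<ge>0. \<exists>B\<ge>0. \<exists>C\<ge>0. second_moment_bound D fi A B C"
      by (rule second_moment_bound_exists[OF D_integrable D_mean D_second_moment fi_C1
            fi_bdd_below fi_smooth])
  qed (blast intro: correlation second_moment)+
qed

end
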